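(* Let $G$ be a finite bipartite graph and let $\{C,H\}$ be a decomposition of $G$. Suppose that all vertices in $V(C)\cap V(H)$ belong to the same bipartite class of $G$ and are all 2-layered in $G$. Then every vertex that is rare in $C$, and every vertex that is rare in $H$, is rare in $G$.
   Context: A stable set of a graph is a set of pairwise non-adjacent vertices; it is maximal if no further vertex can be added while keeping it stable. A vertex $x$ of a finite graph $K$ is rare in $K$ if $x$ lies in at most half of the maximal stable sets of $K$. A decomposition of a graph $G$ is a set of pairwise edge-disjoint subgraphs $H_1,\dots,H_n$ of $G$ whose union (of vertex sets and of edge sets) is $G$. A pendant vertex is a vertex of degree $1$ in $G$. A vertex $v\in V(G)$ is 2-layered (in $G$) if every vertex in $N_G(v)$, the set of neighbours of $v$ in $G$, is adjacent to some pendant vertex of $G$. *)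

theory Defs
  imports Main
begin

record 'a graph =
  verts :: "'a set"
  edges :: "'a set set"

definition simple_graph :: "'a graph \<Rightarrow> bool" where
  "simple_graph G \<longleftrightarrow> (\<forall>e\<in>edges G. e \<subseteq> verts G \<and> card e = 2)"

definition finite_graph :: "'a graph \<Rightarrow> bool" where
  "finite_graph G \<longleftrightarrow> simple_graph G \<and> finite (verts G)"

definition adjacent :: "'a graph \<Rightarrow> 'a \<Rightarrow> 'a \<Rightarrow> bool" where
  "adjacent G u v \<longleftrightarrow> {u, v} \<in> edges G"

definition neighbours :: "'a graph \<Rightarrow> 'a \<Rightarrow> 'a set" where
  "neighbours G v = {u \<in> verts G. adjacent G v u}"

definition degree :: "'a graph \<Rightarrow> 'a \<Rightarrow> nat" where
  "degree G v = card (neighbours G v)"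

definition bipartition :: "'a graph \<Rightarrow> 'a set \<Rightarrow> 'a set \<Rightarrow> bool" where
  "bipartition G A B \<longleftrightarrow> A \<union> B = verts G \<and> A \<inter> B = {} \<and>
     (\<forall>e\<in>edges G. \<exists>a\<in>A. \<exists>b\<in>B. e = {a, b})"

definition stable_set :: "'a graph \<Rightarrow> 'a set \<Rightarrow> bool" where
  "stable_set G S \<longleftrightarrow> S \<subseteq> verts G \<and> (\<forall>u\<in>S. \<forall>v\<in>S. \<not> adjacent G u v)"

definition maximal_stable_set :: "'a graph \<Rightarrow> 'a set \<Rightarrow> bool" where
  "maximal_stable_set G S \<longleftrightarrow>
     stable_set G S \<and> (\<forall>v\<in>verts G - S. \<not> stable_set G (insert v S))"

(* Meaningful for finite graphs only, since card of an infinite set is 0. *)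
definition rare_in :: "'a \<Rightarrow> 'a graph \<Rightarrow> bool" where
  "rare_in x K \<longleftrightarrow> x \<in> verts K \<and>
     2 * card {S. maximal_stable_set K S \<and> x \<in> S} \<le> card {S. maximal_stable_set K S}"

definition subgraph :: "'a graph \<Rightarrow> 'a graph \<Rightarrow> bool" where
  "subgraph H G \<longleftrightarrow> simple_graph H \<and> verts H \<subseteq> verts G \<and> edges H \<subseteq> edges G"

definition decomposition :: "'a graph set \<Rightarrow> 'a graph \<Rightarrow> bool" where
  "decomposition D G \<longleftrightarrow> finite D \<and> (\<forall>K\<in>D. subgraph K G) \<and>
     pairwise (\<lambda>K L. disjnt (edges K) (edges L)) D \<and>
     (\<Union>K\<in>D. verts K) = verts G \<and> (\<Union>K\<in>D. edges K) = edges G"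

definition pendant :: "'a graph \<Rightarrow> 'a \<Rightarrow> bool" where
  "pendant G v \<longleftrightarrow> v \<in> verts G \<and> degree G v = 1"

definition two_layered :: "'a graph \<Rightarrow> 'a \<Rightarrow> bool" where
  "two_layered G v \<longleftrightarrow> v \<in> verts G \<and>
     (\<forall>u\<in>neighbours G v. \<exists>p. pendant G p \<and> adjacent G u p)"

end

theory Submission
  imports Defs "HOL-Library.FuncSet"
begin

text \<open>
  A maximal stable set of a bipartite graph is determined by its trace \<open>T\<close> on the class \<open>B\<close>, and the
  traces are the sets \<open>T \<subseteq> B\<close> such that every \<open>u \<in> B - T\<close> has a neighbour without neighbours in \<open>T\<close>.
  Let the common vertices of \<open>C\<close> and \<open>H\<close> lie in \<open>A\<close>. If \<open>u\<close> is adjacent to a common vertex, then its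
  pendant neighbour witnesses the condition at \<open>u\<close>, both in \<open>G\<close> and in the part containing \<open>u\<close>; for
  every other \<open>u\<close> the condition only involves the part containing \<open>u\<close>. Hence the traces of \<open>G\<close> are
  exactly the unions of a trace of \<open>C\<close> and a trace of \<open>H\<close>. A maximal stable set of \<open>G\<close> containing a
  vertex \<open>x\<close> of \<open>C\<close> induces one of \<open>C\<close> containing \<open>x\<close>, so the proportion of those containing \<open>x\<close> does
  not grow when passing from \<open>C\<close> to \<open>G\<close>.
\<close>

section \<open>Traces of maximal stable sets in a bipartite graph\<close>

definition traces :: "'a graph \<Rightarrow> 'a set \<Rightarrow> 'a set \<Rightarrow> 'a set set" where
  "traces K A B =
     {T. T \<subseteq> B \<and> (\<forall>u\<in>B - T. \<exists>a\<in>A. adjacent K a u \<and> (\<forall>b\<in>T. \<not> adjacent K a b))}"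

text \<open>For a trace \<open>T\<close>, this is the unique maximal stable set meeting
  \<open>B\<close> in \<open>T\<close>.\<close>

definition trace_ext :: "'a graph \<Rightarrow> 'a set \<Rightarrow> 'a set \<Rightarrow> 'a set" where
  "trace_ext K A T = T \<union> {a\<in>A. \<forall>b\<in>T. \<not> adjacent K a b}"

lemma adjacent_commute: "adjacent K u v \<longleftrightarrow> adjacent K v u"
  by (simp add: adjacent_def insert_commute)

lemma bipartition_adjacentD:
  assumes "bipartition K A B" "adjacent K u v"
  shows "u \<in> A \<and> v \<in> B \<or> u \<in> B \<and> v \<in> A"
  using assms unfolding bipartition_def adjacent_def by (fastforce simp: doubleton_eq_iff)

lemma bipartition_commute: "bipartition K A B \<longleftrightarrow> bipartition K B A"
proof -
  have "bipartition K B A" if "bipartition K A B" for A B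
    using that unfolding bipartition_def by (metis Int_commute Un_commute insert_commute)
  then show ?thesis by blast
qed

text \<open>Only pairs involving \<open>v\<close> are new, and a loop at \<open>v\<close> would put
  \<open>v\<close> into both disjoint classes.\<close>

lemma stable_set_insert_iff:
  assumes "bipartition K A B" "stable_set K S" "v \<in> verts K"
  shows "stable_set K (insert v S) \<longleftrightarrow> (\<forall>w\<in>S. \<not> adjacent K v w)"
proof -
  have irrefl: "\<not> adjacent K v v"
    using bipartition_adjacentD[OF assms(1), of v v] assms(1) by (auto simp: bipartition_def)
  show ?thesis
  proof
    assume nadj: "\<forall>w\<in>S. \<not> adjacent K v w"
    have "\<not> adjacent K w v" if "w \<in> S" for w
      by (subst adjacent_commute) (use nadj that in blast)
    then show "stable_set K (insert v S)"
      using nadj irrefl assms(2,3) by (simp add: stable_set_def)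
  qed (simp add: stable_set_def)
qed

text \<open>Neighbours of a vertex of \<open>A\<close> lie in \<open>B\<close>, so maximality
  decides membership on \<open>A\<close> from \<open>S \<inter> B\<close> alone. For
  \<open>u\<close> in \<open>B - S\<close> it yields a neighbour in \<open>S\<close>; this lies in
  \<open>A\<close> and, by stability, is the witness required of a trace.\<close>

lemma maximal_stable_set_iff_trace_ext:
  assumes bip: "bipartition K A B"
  shows "maximal_stable_set K S \<longleftrightarrow> S \<inter> B \<in> traces K A B \<and> S = trace_ext K A (S \<inter> B)"
    (is "?L \<longleftrightarrow> ?R")
proof -
  have V: "verts K = A \<union> B" "A \<inter> B = {}" using bip by (auto simp: bipartition_def)
  note adjD = bipartition_adjacentD[OF bip]
  have ?R if L: ?L
  proof -
    have st: "stable_set K S" and S: "S \<subseteq> A \<union> B"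
      using L by (auto simp: maximal_stable_set_def stable_set_def V)
    have mx: "\<exists>w\<in>S. adjacent K v w" if "v \<in> A \<union> B" "v \<notin> S" for v
      using L that stable_set_insert_iff[OF bip st] by (auto simp: maximal_stable_set_def V)
    have nadj: "\<not> adjacent K u v" if "u \<in> S" "v \<in> S" for u v
      using st that by (auto simp: stable_set_def)
    have A: "v \<in> S \<longleftrightarrow> (\<forall>b\<in>S \<inter> B. \<not> adjacent K v b)" if "v \<in> A" for v
    proof
      show "\<forall>b\<in>S \<inter> B. \<not> adjacent K v b" if "v \<in> S"
        using nadj[OF that] by simp
      show "v \<in> S" if "\<forall>b\<in>S \<inter> B. \<not> adjacent K v b"
      proof (rule ccontr)
        assume "v \<notin> S"
        then obtain w where w: "w \<in> S" "adjacent K v w" using mx[of v] \<open>v \<in> A\<close> by auto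
        have "w \<in> B" using adjD[OF w(2)] \<open>v \<in> A\<close> V(2) by auto
        then show False using w that by auto
      qed
    qed
    have "S = trace_ext K A (S \<inter> B)"
      using S A by (auto simp: trace_ext_def)
    moreover have "\<exists>a\<in>A. adjacent K a u \<and> (\<forall>b\<in>S \<inter> B. \<not> adjacent K a b)"
      if u: "u \<in> B" "u \<notin> S" for u
    proof -
      obtain w where w: "w \<in> S" "adjacent K u w" using mx[of u] u by auto
      have "w \<in> A" using adjD[OF w(2)] u(1) V(2) by auto
      then show ?thesis using A[of w] w adjacent_commute[of K u w] by auto
    qed
    ultimately show ?R by (auto simp: traces_def)
  qed
  moreover have ?L if R: ?R
  proof -
    define T where "T = S \<inter> B"
    have S: "S = T \<union> {a\<in>A. \<forall>b\<in>T. \<not> adjacent K a b}"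
      using R by (simp add: T_def trace_ext_def)
    have tr: "\<exists>a\<in>A. adjacent K a u \<and> (\<forall>b\<in>T. \<not> adjacent K a b)"
      if "u \<in> B" "u \<notin> T" for u
      using R that unfolding T_def[symmetric] by (auto simp: traces_def)
    have nadj': "\<not> adjacent K a b" if "a \<in> A" "b \<in> B" "a \<in> S" "b \<in> S" for a b
    proof -
      have "b \<in> T" "a \<notin> T" using that V(2) by (auto simp: T_def)
      then show ?thesis using S that(3) by auto
    qed
    have nadj: "\<not> adjacent K u v" if "u \<in> S" "v \<in> S" for u v
      using adjD[of u v] nadj'[of u v] nadj'[of v u] that adjacent_commute[of K u v] by blast
    have "S \<subseteq> A \<union> B" by (subst S) (auto simp: T_def)
    then have st: "stable_set K S" using nadj by (auto simp: stable_set_def V)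
    \<comment> \<open>On \<open>A\<close> this is how the extension is built; on \<open>B\<close>
      the witness of the trace condition itself belongs to the extension.\<close>
    have "\<exists>w\<in>S. adjacent K v w" if v: "v \<in> A \<union> B" "v \<notin> S" for v
    proof (cases "v \<in> A")
      case True
      then have "\<exists>b\<in>T. adjacent K v b" using v(2) S by blast
      then show ?thesis by (auto simp: T_def)
    next
      case False
      then obtain a where a: "a \<in> A" "adjacent K a v" "\<forall>b\<in>T. \<not> adjacent K a b"
        using tr[of v] v by (auto simp: T_def)
      then have "a \<in> S" by (subst S) simp
      then show ?thesis using a(2) adjacent_commute[of K a v] by blast
    qed
    then show ?L
      using st stable_set_insert_iff[OF bip st] by (auto simp: maximal_stable_set_def V)
  qed
  ultimately show ?thesis by blast
qed

text \<open>The inverse is intersection with \<open>B\<close>: the vertices added by the extension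
  lie in \<open>A\<close>, so they leave the trace unchanged.\<close>

lemma bij_betw_trace_ext:
  assumes bip: "bipartition K A B"
  shows "bij_betw (trace_ext K A) (traces K A B) {S. maximal_stable_set K S}"
proof -
  have ext_Int: "trace_ext K A T \<inter> B = T" if "T \<in> traces K A B" for T
  proof -
    have "T \<subseteq> B" "A \<inter> B = {}" using that bip by (simp_all add: traces_def bipartition_def)
    then show ?thesis unfolding trace_ext_def by blast
  qed
  note mss_iff = maximal_stable_set_iff_trace_ext[OF bip]
  have mssD: "S \<inter> B \<in> traces K A B \<and> S = trace_ext K A (S \<inter> B)"
    if "S \<in> {S. maximal_stable_set K S}" for S
    by (rule iffD1[OF mss_iff]) (rule CollectD[OF that])
  show ?thesis
  proof (rule bij_betwI[where g = "\<lambda>S. S \<inter> B"])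
    show "trace_ext K A \<in> traces K A B \<rightarrow> {S. maximal_stable_set K S}"
    proof
      fix T assume T: "T \<in> traces K A B"
      have "maximal_stable_set K (trace_ext K A T)"
        by (rule iffD2[OF mss_iff]) (simp add: ext_Int[OF T] T)
      then show "trace_ext K A T \<in> {S. maximal_stable_set K S}" by simp
    qed
    show "(\<lambda>S. S \<inter> B) \<in> {S. maximal_stable_set K S} \<rightarrow> traces K A B"
      by (intro funcsetI) (rule conjunct1[OF mssD])
    show "trace_ext K A (S \<inter> B) = S" if "S \<in> {S. maximal_stable_set K S}" for S
      using mssD[OF that] by (rule conjunct2[THEN sym])
  qed (rule ext_Int)
qed

text \<open>Counting traces instead of stable sets prepares for the product structure of the traces
  of \<open>G\<close>.\<close>

lemma rare_in_iff_traces: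
  assumes bip: "bipartition K A B"
  shows "rare_in x K \<longleftrightarrow> x \<in> verts K \<and>
    2 * card {T\<in>traces K A B. x \<in> trace_ext K A T} \<le> card (traces K A B)"
proof -
  note bij = bij_betw_trace_ext[OF bip]
  have "trace_ext K A ` {T\<in>traces K A B. x \<in> trace_ext K A T} =
      {S. maximal_stable_set K S \<and> x \<in> S}"
    using bij unfolding bij_betw_def by blast
  then have "bij_betw (trace_ext K A) {T\<in>traces K A B. x \<in> trace_ext K A T}
      {S. maximal_stable_set K S \<and> x \<in> S}"
    by (rule bij_betw_subset[OF bij, rotated]) blast
  from bij_betw_same_card[OF this] bij_betw_same_card[OF bij] show ?thesis
    by (simp add: rare_in_def)
qed

section \<open>Bipartite subgraphs and pendant vertices\<close>

lemma bipartition_subgraph: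
  assumes bip: "bipartition G A B" and sub: "subgraph K G"
  shows "bipartition K (A \<inter> verts K) (B \<inter> verts K)"
  unfolding bipartition_def
proof (intro conjI ballI)
  have "verts K \<subseteq> A \<union> B" "A \<inter> B = {}"
    using bip sub by (simp_all add: bipartition_def subgraph_def)
  then show "A \<inter> verts K \<union> B \<inter> verts K = verts K" "A \<inter> verts K \<inter> (B \<inter> verts K) = {}"
    by blast+
next
  fix e assume "e \<in> edges K"
  then have e: "e \<in> edges G" "e \<subseteq> verts K"
    using sub by (auto simp: subgraph_def simple_graph_def)
  then obtain a b where "a \<in> A" "b \<in> B" "e = {a, b}"
    using bip unfolding bipartition_def by meson
  with e(2) show "\<exists>a\<in>A \<inter> verts K. \<exists>b\<in>B \<inter> verts K. e = {a, b}"
    by (intro bexI[of _ a] bexI[of _ b]) simp_all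
qed

lemma subgraph_adjacentD:
  assumes "subgraph K G" "adjacent K u v"
  shows "adjacent G u v" "u \<in> verts K" "v \<in> verts K"
  using assms by (auto simp: subgraph_def simple_graph_def adjacent_def)

lemma pendant_neighbour_unique:
  assumes "pendant G p" "adjacent G p u" "adjacent G p v" "u \<in> verts G" "v \<in> verts G"
  shows "u = v"
proof -
  obtain w where "neighbours G p = {w}"
    using assms(1) by (auto simp: pendant_def degree_def card_1_singleton_iff)
  moreover have "u \<in> neighbours G p" "v \<in> neighbours G p"
    using assms by (simp_all add: neighbours_def)
  ultimately show ?thesis by simp
qed

section \<open>Gluing two graphs along 2-layered vertices of one class\<close>

locale two_layered_gluing =
  fixes G C H :: "'a graph" and A B :: "'a set"
  assumes bip: "bipartition G A B"
    and subC: "subgraph C G" and subH: "subgraph H G"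
    and verts_Un: "verts C \<union> verts H = verts G"
    and edges_Un: "edges C \<union> edges H = edges G"
    and common: "verts C \<inter> verts H \<subseteq> A"
    and layered: "v \<in> verts C \<inter> verts H \<Longrightarrow> two_layered G v"
begin

text \<open>By this symmetry every fact proved for \<open>C\<close> transfers to
  \<open>H\<close>.\<close>

lemma swap: "two_layered_gluing G H C A B"
  using bip subC subH verts_Un edges_Un common layered by unfold_locales auto

lemma adjacent_cases: "adjacent G u v \<Longrightarrow> adjacent C u v \<or> adjacent H u v"
  using edges_Un by (auto simp: adjacent_def)

text \<open>Common vertices lie in \<open>A\<close>, so \<open>b\<close> is outside \<open>H\<close>
  and every edge of \<open>G\<close> at \<open>b\<close> comes from \<open>C\<close>.\<close>

lemma adjacent_part:
  assumes "b \<in> B" "b \<in> verts C" "adjacent G a b"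
  shows "adjacent C a b"
proof -
  have "b \<notin> verts H" using assms common bip by (auto simp: bipartition_def)
  then show ?thesis using adjacent_cases assms(3) subgraph_adjacentD[OF subH] by blast
qed

text \<open>A witness in \<open>G\<close> also serves in \<open>C\<close>, where there are fewer
  adjacencies. Conversely, a witness in \<open>C\<close> can fail in \<open>G\<close> only if it is
  a common vertex, and then a pendant vertex replaces it.\<close>

lemma trace_condition_part:
  assumes T: "T \<subseteq> B" and u: "u \<in> B" "u \<in> verts C" "u \<notin> T"
  shows "(\<exists>a\<in>A. adjacent G a u \<and> (\<forall>b\<in>T. \<not> adjacent G a b)) \<longleftrightarrow>
    (\<exists>a\<in>A \<inter> verts C. adjacent C a u \<and> (\<forall>b\<in>T \<inter> verts C. \<not> adjacent C a b))"
    (is "?L \<longleftrightarrow> ?R")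
proof
  assume ?L
  then obtain a where a: "a \<in> A" "adjacent G a u" "\<forall>b\<in>T. \<not> adjacent G a b" by auto
  note aC = adjacent_part[OF u(1,2) a(2)]
  have "\<not> adjacent C a b" if "b \<in> T" for b
    using a(3) that subgraph_adjacentD(1)[OF subC, of a b] by auto
  then show ?R using a(1) aC subgraph_adjacentD(2)[OF subC aC] by auto
next
  assume ?R
  then obtain a where a: "a \<in> A" "a \<in> verts C" "adjacent C a u"
    and nb: "\<forall>b\<in>T \<inter> verts C. \<not> adjacent C a b" by auto
  have au: "adjacent G a u" using subgraph_adjacentD[OF subC a(3)] by simp
  have uG: "u \<in> verts G" using u(1) bip by (auto simp: bipartition_def)
  show ?L
  proof (cases "a \<in> verts H")
    case False
    \<comment> \<open>Since \<open>a\<close> is outside \<open>H\<close>, all its edges lie in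
      \<open>C\<close>, so the same witness works.\<close>
    then have "\<not> adjacent G a b" if "b \<in> T" for b
      using that nb adjacent_cases[of a b] subgraph_adjacentD[OF subC, of a b]
        subgraph_adjacentD[OF subH, of a b] by auto
    then show ?thesis using a(1) au by auto
  next
    case True
    \<comment> \<open>Here \<open>a\<close> may have a neighbour of \<open>H\<close> in
      \<open>T\<close>. As \<open>a\<close> is 2-layered, \<open>u\<close> has a pendant neighbour
      \<open>p\<close>, whose only neighbour \<open>u\<close> is not in \<open>T\<close>.\<close>
    have "u \<in> neighbours G a" using au uG by (simp add: neighbours_def)
    then obtain p where p: "pendant G p" "adjacent G u p"
      using layered[of a] a(2) True by (auto simp: two_layered_def)
    have pu: "adjacent G p u" using p(2) adjacent_commute by metis
    have "p \<in> A"
      using bipartition_adjacentD[OF bip pu] u(1) bip by (auto simp: bipartition_def)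
    moreover have "\<not> adjacent G p b" if "b \<in> T" for b
    proof
      assume "adjacent G p b"
      moreover have "b \<in> verts G" using that T bip by (auto simp: bipartition_def)
      ultimately have "u = b" using pendant_neighbour_unique[OF p(1) pu] uG by blast
      then show False using that u(3) by simp
    qed
    ultimately show ?thesis using pu by auto
  qed
qed

lemma trace_part_iff:
  assumes "T \<subseteq> B"
  shows "T \<inter> verts C \<in> traces C (A \<inter> verts C) (B \<inter> verts C) \<longleftrightarrow>
    (\<forall>u\<in>B \<inter> verts C - T. \<exists>a\<in>A. adjacent G a u \<and> (\<forall>b\<in>T. \<not> adjacent G a b))"
  using assms trace_condition_part[OF assms] unfolding traces_def by auto

text \<open>Each \<open>u\<close> in \<open>B\<close> lies in \<open>C\<close> or \<open>H\<close>,
  and its condition in \<open>G\<close> is equivalent to the one in that part.\<close>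

lemma traces_iff:
  "T \<in> traces G A B \<longleftrightarrow> T \<subseteq> B \<and>
     T \<inter> verts C \<in> traces C (A \<inter> verts C) (B \<inter> verts C) \<and>
     T \<inter> verts H \<in> traces H (A \<inter> verts H) (B \<inter> verts H)"
proof (cases "T \<subseteq> B")
  case True
  have "B \<subseteq> verts C \<union> verts H" using bip verts_Un by (auto simp: bipartition_def)
  then show ?thesis
    unfolding trace_part_iff[OF True] two_layered_gluing.trace_part_iff[OF swap True]
    using True by (auto simp: traces_def)
qed (simp add: traces_def)

text \<open>The vertex sets of \<open>C\<close> and \<open>H\<close> cut \<open>B\<close> into
  disjoint pieces, so uniting the two traces inverts the restriction.\<close>

lemma bij_betw_traces:
  "bij_betw (\<lambda>T. (T \<inter> verts C, T \<inter> verts H)) (traces G A B)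
     (traces C (A \<inter> verts C) (B \<inter> verts C) \<times> traces H (A \<inter> verts H) (B \<inter> verts H))"
    (is "bij_betw ?f _ (?TC \<times> ?TH)")
proof (rule bij_betwI[where g = "\<lambda>p. fst p \<union> snd p"])
  have B: "B \<subseteq> verts C \<union> verts H" "B \<inter> (verts C \<inter> verts H) = {}"
    using bip verts_Un common by (auto simp: bipartition_def)
  have inter: "?f (fst p \<union> snd p) = p" "fst p \<union> snd p \<subseteq> B" if "p \<in> ?TC \<times> ?TH" for p
  proof -
    obtain T U where p: "p = (T, U)" by fastforce
    then have "T \<subseteq> B \<inter> verts C" "U \<subseteq> B \<inter> verts H"
      using that by (simp_all add: traces_def)
    then have "(T \<union> U) \<inter> verts C = T" "(T \<union> U) \<inter> verts H = U" "T \<union> U \<subseteq> B"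
      using B(2) by blast+
    then show "?f (fst p \<union> snd p) = p" "fst p \<union> snd p \<subseteq> B"
      unfolding p by simp_all
  qed
  show "?f \<in> traces G A B \<rightarrow> ?TC \<times> ?TH"
    by (auto simp: traces_iff)
  show "(\<lambda>p. fst p \<union> snd p) \<in> ?TC \<times> ?TH \<rightarrow> traces G A B"
  proof
    fix p assume p: "p \<in> ?TC \<times> ?TH"
    then have "?f (fst p \<union> snd p) \<in> ?TC \<times> ?TH" using inter(1)[OF p] by (simp only:)
    then show "fst p \<union> snd p \<in> traces G A B"
      unfolding traces_iff using inter(2)[OF p] by blast
  qed
  show "fst (?f T) \<union> snd (?f T) = T" if "T \<in> traces G A B" for T
    using that B(1) by (auto simp: traces_def)
  show "?f (fst p \<union> snd p) = p" if "p \<in> ?TC \<times> ?TH" for p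
    using inter(1)[OF that] .
qed

text \<open>Passing to \<open>C\<close> only removes adjacencies. The converse can fail for a common
  \<open>x\<close> with a neighbour of \<open>H\<close> in \<open>T\<close>, so rarity is compared
  by an inequality.\<close>

lemma trace_ext_part:
  assumes "x \<in> verts C" "x \<in> trace_ext G A T"
  shows "x \<in> trace_ext C (A \<inter> verts C) (T \<inter> verts C)"
  using assms subgraph_adjacentD(1)[OF subC] unfolding trace_ext_def by blast

text \<open>The traces of \<open>G\<close> whose extension contains \<open>x\<close> inject into
  \<open>TCx \<times> TH\<close>, while all traces of \<open>G\<close> number
  \<open>card TC * card TH\<close>; the factor \<open>card TH\<close> preserves the bound for
  \<open>C\<close>.\<close>

lemma rare_in_part:
  assumes fin: "finite (verts G)" and rare: "rare_in x C"
  shows "rare_in x G"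
proof -
  define TC where "TC = traces C (A \<inter> verts C) (B \<inter> verts C)"
  define TH where "TH = traces H (A \<inter> verts H) (B \<inter> verts H)"
  define TCx where "TCx = {T\<in>TC. x \<in> trace_ext C (A \<inter> verts C) T}"
  define f where "f = (\<lambda>T. (T \<inter> verts C, T \<inter> verts H))"
  have x: "x \<in> verts C" and le: "2 * card TCx \<le> card TC"
    using rare rare_in_iff_traces[OF bipartition_subgraph[OF bip subC]]
    by (auto simp: TC_def TCx_def)
  have "finite B" using fin bip by (auto simp: bipartition_def dest: finite_subset[rotated])
  then have finT: "finite TC" "finite TH"
    unfolding TC_def TH_def traces_def
    by (auto intro: finite_subset[of _ "Pow B"])
  have bij: "bij_betw f (traces G A B) (TC \<times> TH)"
    using bij_betw_traces unfolding TC_def TH_def f_def .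
  have "f T \<in> TCx \<times> TH" if "T \<in> traces G A B" "x \<in> trace_ext G A T" for T
    using bij_betwE[OF bij] that trace_ext_part[OF x] by (auto simp: TCx_def f_def)
  then have image: "f ` {T\<in>traces G A B. x \<in> trace_ext G A T} \<subseteq> TCx \<times> TH"
    by blast
  have inj: "inj_on f {T\<in>traces G A B. x \<in> trace_ext G A T}"
    using bij_betw_imp_inj_on[OF bij] by (rule inj_on_subset) blast
  have "finite (TCx \<times> TH)"
    using finT by (simp add: TCx_def)
  then have "card {T\<in>traces G A B. x \<in> trace_ext G A T} \<le> card (TCx \<times> TH)"
    by (rule card_inj_on_le[OF inj image])
  also have "2 * card (TCx \<times> TH) \<le> card (TC \<times> TH)"
    using le by (simp add: card_cartesian_product mult_le_mono1 flip: mult.assoc)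
  also have "card (TC \<times> TH) = card (traces G A B)"
    using bij_betw_same_card[OF bij] by simp
  finally show ?thesis
    using x verts_Un unfolding rare_in_iff_traces[OF bip] by auto
qed

end

theorem theorem3p2:
  fixes G C H :: "'a graph" and A B :: "'a set"
  assumes "finite_graph G"
    and "bipartition G A B"
    and "decomposition {C, H} G"
    and "verts C \<inter> verts H \<subseteq> A \<or> verts C \<inter> verts H \<subseteq> B"
    and "\<forall>v \<in> verts C \<inter> verts H. two_layered G v"
  shows "(\<forall>x. rare_in x C \<longrightarrow> rare_in x G) \<and> (\<forall>x. rare_in x H \<longrightarrow> rare_in x G)"
proof -
  \<comment> \<open>\<open>A'\<close> is whichever class contains the common vertices.\<close>
  obtain A' B' where "bipartition G A' B'" "verts C \<inter> verts H \<subseteq> A'"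
    using assms(2,4) bipartition_commute by blast
  then interpret two_layered_gluing G C H A' B'
    using assms(3,5) by unfold_locales (auto simp: decomposition_def)
  show ?thesis
    using assms(1) rare_in_part two_layered_gluing.rare_in_part[OF swap]
    by (auto simp: finite_graph_def)
qed

end
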